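(* Let $X$ be a bounded ultrametric space and let $Y$ be a complete metric space. If $$\dim_{\mathrm A}X<\dim_{\mathrm{LA}}Y,$$ where $\dim_{\mathrm A}X$ is the Assouad dimension of $X$ and $\dim_{\mathrm{LA}}Y$ is the lower Assouad dimension of $Y$, then $X$ admits a bi-Lipschitz embedding into $Y$.
   Context: An ultrametric space is a metric space with $d(x,z)\le\max\{d(x,y),d(y,z)\}$ for all $x,y,z$. For a metric space $X$, a subset $E\subseteq X$ and $r>0$, $N_X(E,r)$ denotes the smallest number of balls of radius $r$ required to cover $E$ ($\infty$ if no finite cover exists). The Assouad dimension $\dim_{\mathrm A}X$ is the infimum of all $s\ge 0$ for which there exists $C\ge 1$ such that $N_X(B_X(x,R),r)\le C(R/r)^s$ for every $x\in X$ and $0<r<R$. The lower Assouad dimension $\dim_{\mathrm{LA}}Y$ is the supremum of all $q\ge 0$ for which there exists $c_Y>0$ such that $N_Y(B_Y(y,R),r)\ge c_Y(R/r)^q$ for every $y\in Y$ and every $0<r<R<\operatorname{diam}(Y)$ (the condition $R<\operatorname{diam}(Y)$ is omitted if $Y$ is unbounded). A map $f:X\to Y$ is a bi-Lipschitz embedding if there are constants $k,K>0$ with $\frac1k d_X(x,y)\le d_Y(f(x),f(y))\le K d_X(x,y)$ for all $x,y\in X$.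
   Formalization: Y is additionally assumed to have at least two points: for a one-point Y the condition defining the lower Assouad dimension is vacuous, so it is infinite, and a two-point X (Assouad dimension 0) would be a counterexample. *)

theory Defs
  imports "HOL-Analysis.Analysis"
begin

text \<open>
  A metric space is a set \<open>X\<close> in a type of class \<^class>\<open>metric_space\<close>, with the induced
  distance. All notions below are intrinsic to \<open>X\<close>: the centres of balls lie in \<open>X\<close>, and a ball of
  \<open>X\<close> is the trace on \<open>X\<close> of an ambient ball. Balls are open; closed balls yield the same
  dimensions.
\<close>

definition ultrametric_on :: "'a::metric_space set \<Rightarrow> bool" where
  "ultrametric_on X \<longleftrightarrow>
     (\<forall>x\<in>X. \<forall>y\<in>X. \<forall>z\<in>X. dist x z \<le> max (dist x y) (dist y z))"

definition ball_in :: "'a::metric_space set \<Rightarrow> 'a \<Rightarrow> real \<Rightarrow> 'a set" where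
  "ball_in X x r = X \<inter> ball x r"

text \<open>The infimum of the empty set in \<^typ>\<open>enat\<close> is \<open>\<infinity>\<close>.\<close>

definition covering_number :: "'a::metric_space set \<Rightarrow> 'a set \<Rightarrow> real \<Rightarrow> enat" where
  "covering_number X E r =
     Inf {enat (card \<B>) | \<B>.
            finite \<B> \<and> \<B> \<subseteq> (\<lambda>x. ball_in X x r) ` X \<and> E \<subseteq> \<Union>\<B>}"

definition assouad_dim :: "'a::metric_space set \<Rightarrow> ereal" where
  "assouad_dim X =
     Inf {ereal s | s. 0 \<le> s \<and>
       (\<exists>C\<ge>1. \<forall>x\<in>X. \<forall>r R. 0 < r \<longrightarrow> r < R \<longrightarrow>
          ereal_of_enat (covering_number X (ball_in X x R) r) \<le> ereal (C * (R / r) powr s))}"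

text \<open>
  If \<open>Y\<close> has at most one point then \<open>diameter Y = 0\<close>, the condition on \<open>q\<close> is vacuous and the value
  is \<open>\<infinity>\<close>.
\<close>

definition lower_assouad_dim :: "'a::metric_space set \<Rightarrow> ereal" where
  "lower_assouad_dim Y =
     Sup {ereal q | q. 0 \<le> q \<and>
       (\<exists>c>0. \<forall>y\<in>Y. \<forall>r R. 0 < r \<longrightarrow> r < R \<longrightarrow> (bounded Y \<longrightarrow> R < diameter Y) \<longrightarrow>
          ereal (c * (R / r) powr q) \<le> ereal_of_enat (covering_number Y (ball_in Y y R) r))}"

definition bilipschitz_embedding ::
  "('a::metric_space \<Rightarrow> 'b::metric_space) \<Rightarrow> 'a set \<Rightarrow> 'b set \<Rightarrow> bool" where
  "bilipschitz_embedding f X Y \<longleftrightarrow>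
     f ` X \<subseteq> Y \<and>
     (\<exists>k>0. \<exists>K>0. \<forall>x\<in>X. \<forall>y\<in>X.
        1 / k * dist x y \<le> dist (f x) (f y) \<and> dist (f x) (f y) \<le> K * dist x y)"

end

theory Submission
  imports Defs
begin

text \<open>
  In an ultrametric space the open balls of a fixed radius partition the space, so the balls of radii
  \<open>D \<lambda>^n\<close>, for \<open>D\<close> exceeding all distances in \<open>X\<close>, form a tree. If \<open>s\<close> is admissible in the
  definition of the Assouad dimension of \<open>X\<close>, a vertex of this tree has at most \<open>C \<lambda>^(-s)\<close> children.
  If \<open>q\<close> is admissible in the definition of the lower Assouad dimension of \<open>Y\<close>, a ball of radius
  \<open>\<rho>\<close> in \<open>Y\<close>, with \<open>\<rho>\<close> below the diameter of \<open>Y\<close> and \<open>\<lambda> < 1/4\<close>, contains at least \<open>c (4 \<lambda>)^(-q)\<close> points with mutual distances at least \<open>4 \<lambda> \<rho>\<close>.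
  The hypothesis gives such \<open>s\<close> and \<open>q\<close> with \<open>s < q\<close>, and then for small \<open>\<lambda>\<close> there are enough
  separated points in \<open>Y\<close> to receive the children of every vertex.

  Hence the tree can be drawn in \<open>Y\<close> from the root downwards: a vertex of level \<open>n\<close>
  is placed within \<open>R \<lambda>^n\<close> of all its children, and distinct children of one vertex are placed at
  distance at least \<open>4 R \<lambda>^(n+1)\<close> from each other (\<open>exists_refined_placement\<close>).
  Following a branch, the placements form a Cauchy sequence, and \<open>x\<close> is mapped to its limit along
  the branch through \<open>x\<close>. The limit stays within \<open>4/3 R \<lambda>^n\<close> of the \<open>n\<close>-th placement, which is
  small enough for the separation of the children to survive. Two points that are separated
  exactly when passing from level \<open>n\<close> to level \<open>n+1\<close> have distance comparable to \<open>\<lambda>^n\<close>,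
  in \<open>X\<close> and in the image (\<open>exists_bilipschitz_embedding_of_covering_numbers\<close>).
\<close>

section \<open>Covering numbers and separated sets\<close>

text \<open>
  A separated set with too few points is never maximal: the balls around its points would otherwise
  form a cheaper cover.
\<close>

lemma separated_subset_of_covering_number:
  assumes "E \<subseteq> Y" and "0 < r" and "enat m \<le> covering_number Y E r"
  shows "\<exists>S\<subseteq>E. finite S \<and> card S = m \<and> (\<forall>a\<in>S. \<forall>b\<in>S. a \<noteq> b \<longrightarrow> r \<le> dist a b)"
  using assms(3)
proof (induction m)
  case 0
  show ?case by (rule exI[of _ "{}"]) simp
next
  case (Suc m)
  have "enat m \<le> covering_number Y E r"
    using Suc.prems by (meson enat_ord_simps(1) le_SucI order.trans order_refl)
  with Suc.IH obtain S where S: "S \<subseteq> E" "finite S" "card S = m"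
    and sep: "\<forall>a\<in>S. \<forall>b\<in>S. a \<noteq> b \<longrightarrow> r \<le> dist a b"
    by blast
  let ?B = "(\<lambda>x. ball_in Y x r) ` S"
  have "\<not> E \<subseteq> \<Union>?B"
  proof
    assume cov: "E \<subseteq> \<Union>?B"
    have "covering_number Y E r \<le> enat (card ?B)"
      unfolding covering_number_def
      by (rule Inf_lower) (use cov S assms(1) in blast)
    also have "\<dots> \<le> enat m"
      using card_image_le[OF S(2)] S(3) by simp
    finally have "enat (Suc m) \<le> enat m"
      using Suc.prems order.trans by blast
    then show False by simp
  qed
  then obtain p where p: "p \<in> E" "p \<notin> \<Union>?B"
    by blast
  have far: "r \<le> dist a p" if "a \<in> S" for a
    using p that assms(1) by (force simp: ball_in_def)
  have "p \<notin> S"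
    using far[of p] assms(2) by auto
  moreover have "\<forall>a\<in>insert p S. \<forall>b\<in>insert p S. a \<noteq> b \<longrightarrow> r \<le> dist a b"
    using sep far by (auto simp: dist_commute)
  ultimately show ?case
    using S p(1) by (intro exI[of _ "insert p S"]) auto
qed

lemma covering_number_attained:
  assumes "covering_number X E r \<noteq> \<infinity>"
  obtains \<B> where "finite \<B>" "\<B> \<subseteq> (\<lambda>x. ball_in X x r) ` X" "E \<subseteq> \<Union>\<B>"
    "covering_number X E r = enat (card \<B>)"
proof -
  let ?A = "{enat (card \<B>) | \<B>. finite \<B> \<and> \<B> \<subseteq> (\<lambda>x. ball_in X x r) ` X \<and> E \<subseteq> \<Union>\<B>}"
  have "?A \<noteq> {}"
    using assms unfolding covering_number_def by (metis Inf_enat_def)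
  then have "Inf ?A \<in> ?A"
    by (metis (no_types, lifting) Inf_enat_def LeastI_ex all_not_in_conv)
  then show ?thesis
    using that unfolding covering_number_def by blast
qed

section \<open>The tree of balls of an ultrametric space\<close>

lemma ultrametric_ball_in_eq:
  assumes "ultrametric_on X" and "x \<in> X" and "y \<in> X" and "dist x y < r"
  shows "ball_in X x r = ball_in X y r"
proof -
  have "dist y z < r" if "z \<in> X" "dist x z < r" for z
  proof -
    have "dist y z \<le> max (dist y x) (dist x z)"
      using assms(1-3) that(1) unfolding ultrametric_on_def by blast
    then show ?thesis using that(2) assms(4) by (simp add: dist_commute max_def split: if_splits)
  qed
  moreover have "dist x z < r" if "z \<in> X" "dist y z < r" for z
  proof -
    have "dist x z \<le> max (dist x y) (dist y z)"
      using assms(1-3) that(1) unfolding ultrametric_on_def by blast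
    then show ?thesis using that(2) assms(4) by (simp add: max_def split: if_splits)
  qed
  ultimately show ?thesis
    by (auto simp: ball_in_def)
qed

lemma ball_in_eq_imp_dist_less:
  assumes "ball_in X x r = ball_in X y r" and "y \<in> X" and "0 < r"
  shows "dist x y < r"
proof -
  have "y \<in> ball_in X y r" using assms by (simp add: ball_in_def)
  then show ?thesis using assms(1) by (auto simp: ball_in_def)
qed

text \<open>
  Any ball of radius \<open>r\<close> that contains \<open>z\<close> is the ball around \<open>z\<close>. Therefore every cover
  of \<open>E\<close> by such balls already lists all the balls centred in \<open>E\<close>.
\<close>

lemma ultrametric_card_balls_le_covering_number:
  assumes "ultrametric_on X" and "E \<subseteq> X" and "covering_number X E r \<noteq> \<infinity>"
  shows "finite ((\<lambda>z. ball_in X z r) ` E)"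
    and "enat (card ((\<lambda>z. ball_in X z r) ` E)) \<le> covering_number X E r"
proof -
  obtain \<B> where B: "finite \<B>" "\<B> \<subseteq> (\<lambda>x. ball_in X x r) ` X" "E \<subseteq> \<Union>\<B>"
    "covering_number X E r = enat (card \<B>)"
    using covering_number_attained[OF assms(3)] .
  have sub: "(\<lambda>z. ball_in X z r) ` E \<subseteq> \<B>"
  proof clarify
    fix z assume z: "z \<in> E"
    then obtain A where A: "A \<in> \<B>" "z \<in> A"
      using B(3) by blast
    then obtain w where w: "w \<in> X" "A = ball_in X w r"
      using B(2) by blast
    have "z \<in> X" "dist w z < r"
      using A(2) w(2) by (auto simp: ball_in_def)
    then have "ball_in X w r = ball_in X z r"
      using ultrametric_ball_in_eq[OF assms(1) w(1)] by blast
    then show "ball_in X z r \<in> \<B>" using A(1) w(2) by simp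
  qed
  show "finite ((\<lambda>z. ball_in X z r) ` E)"
    using sub B(1) finite_subset by blast
  show "enat (card ((\<lambda>z. ball_in X z r) ` E)) \<le> covering_number X E r"
    using card_mono[OF B(1) sub] B(4) by simp
qed

text \<open>
  A placement of the tree at radius \<open>a\<close> is encoded as a map \<open>F\<close> on points that is constant on balls
  of radius \<open>a\<close>. The comparison of covering numbers says that around each placed ball
  there is room for all its subballs of radius \<open>a'\<close>.
\<close>

lemma exists_refined_placement:
  assumes X: "ultrametric_on X" and r: "0 < r"
    and fin: "\<And>x. x \<in> X \<Longrightarrow> covering_number X (ball_in X x a) a' \<noteq> \<infinity>"
    and le: "\<And>x y. x \<in> X \<Longrightarrow> y \<in> Y \<Longrightarrow>
      covering_number X (ball_in X x a) a' \<le> covering_number Y (ball_in Y y R) r"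
    and a: "0 < a'" "a' \<le> a"
    and FY: "F ` X \<subseteq> Y"
    and const: "\<forall>x\<in>X. \<forall>y\<in>X. dist x y < a \<longrightarrow> F x = F y"
  shows "\<exists>G. (G ` X \<subseteq> Y \<and> (\<forall>x\<in>X. \<forall>y\<in>X. dist x y < a' \<longrightarrow> G x = G y)) \<and>
    (\<forall>x\<in>X. dist (F x) (G x) < R) \<and>
    (\<forall>x\<in>X. \<forall>y\<in>X. dist x y < a \<longrightarrow> a' \<le> dist x y \<longrightarrow> r \<le> dist (G x) (G y))"
proof -
  let ?b = "\<lambda>z. ball_in X z a'"
  let ?ok = "\<lambda>B h. (\<forall>z\<in>B. h (?b z) \<in> ball_in Y (F z) R) \<and>
    (\<forall>z\<in>B. \<forall>w\<in>B. ?b z \<noteq> ?b w \<longrightarrow> r \<le> dist (h (?b z)) (h (?b w)))"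
  have "\<exists>h. ?ok B h" if B: "B \<in> (\<lambda>x. ball_in X x a) ` X" for B
  proof -
    obtain x where x: "x \<in> X" "B = ball_in X x a" using B by blast
    have Fx: "F x \<in> Y" using FY x by blast
    have BX: "B \<subseteq> X" by (auto simp: x ball_in_def)
    have FB: "F z = F x" if "z \<in> B" for z
      using that x const by (auto simp: ball_in_def dist_commute)
    note children = ultrametric_card_balls_le_covering_number[OF X BX fin[OF x(1), folded x(2)]]
    have "enat (card (?b ` B)) \<le> covering_number Y (ball_in Y (F x) R) r"
      using children(2) le[OF x(1) Fx] x(2) by (metis order.trans)
    then obtain S where S: "S \<subseteq> ball_in Y (F x) R" "finite S" "card S = card (?b ` B)"
      and sep: "\<forall>a\<in>S. \<forall>b\<in>S. a \<noteq> b \<longrightarrow> r \<le> dist a b"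
      using separated_subset_of_covering_number[of "ball_in Y (F x) R" Y r] r
      by (metis ball_in_def inf_le1)
    obtain h where h: "bij_betw h (?b ` B) S"
      using finite_same_card_bij[OF children(1) S(2)] S(3) by auto
    have hS: "h (?b z) \<in> S" if "z \<in> B" for z
      using h that by (auto simp: bij_betw_def)
    have "r \<le> dist (h (?b z)) (h (?b w))" if "z \<in> B" "w \<in> B" "?b z \<noteq> ?b w" for z w
    proof -
      have "h (?b z) \<noteq> h (?b w)"
        using h that unfolding bij_betw_def inj_on_def by blast
      then show ?thesis using sep hS that by blast
    qed
    moreover have "h (?b z) \<in> ball_in Y (F z) R" if "z \<in> B" for z
      using hS[OF that] S(1) FB[OF that] by auto
    ultimately show ?thesis by blast
  qed
  \<comment> \<open>One choice per ball, not per point, so that \<open>G\<close> is constant on the smaller balls.\<close>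
  then obtain H where H: "\<And>B. B \<in> (\<lambda>x. ball_in X x a) ` X \<Longrightarrow> ?ok B (H B)"
    by metis
  define G where "G x = H (ball_in X x a) (?b x)" for x
  have self: "x \<in> ball_in X x a" if "x \<in> X" for x
    using that a by (simp add: ball_in_def)
  have G: "G x \<in> ball_in Y (F x) R" if "x \<in> X" for x
    using H[of "ball_in X x a"] self that unfolding G_def by blast
  have "G x = G y" if "x \<in> X" "y \<in> X" "dist x y < a'" for x y
    unfolding G_def
    using ultrametric_ball_in_eq[OF X that] ultrametric_ball_in_eq[OF X that(1,2), of a] that(3) a(2)
    by simp
  moreover have "r \<le> dist (G x) (G y)" if "x \<in> X" "y \<in> X" "dist x y < a" "a' \<le> dist x y" for x y
  proof -
    have eq: "ball_in X x a = ball_in X y a"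
      using ultrametric_ball_in_eq[OF X that(1-3)] .
    have "?b x \<noteq> ?b y"
      using ball_in_eq_imp_dist_less[of X x a' y] that a(1) by auto
    then show ?thesis
      using H[of "ball_in X x a"] self[OF that(1)] self[OF that(2)] that(1) eq
      unfolding G_def by auto
  qed
  ultimately show ?thesis
    using G by (intro exI[of _ G]) (auto simp: ball_in_def)
qed

section \<open>Limits along branches\<close>

lemma geometric_steps_converge:
  fixes u :: "nat \<Rightarrow> 'b::metric_space"
  assumes "complete Y" and "\<And>n. u n \<in> Y" and l: "0 < l" "l < 1" and "0 \<le> R"
    and step: "\<And>n. dist (u n) (u (Suc n)) \<le> R * l ^ n"
  shows "\<exists>p\<in>Y. \<forall>n. dist (u n) p \<le> R * l ^ n / (1 - l)"
proof -
  have partial: "dist (u n) (u (n + k)) \<le> R * l ^ n * (1 - l ^ k) / (1 - l)" for n k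
  proof (induction k)
    case 0
    show ?case by simp
  next
    case (Suc k)
    have "dist (u n) (u (n + Suc k)) \<le> dist (u n) (u (n + k)) + dist (u (n + k)) (u (n + Suc k))"
      by (rule dist_triangle)
    also have "\<dots> \<le> R * l ^ n * (1 - l ^ k) / (1 - l) + R * l ^ (n + k)"
      using Suc.IH step[of "n + k"] by simp
    also have "\<dots> = R * l ^ n * (1 - l ^ Suc k) / (1 - l)"
      using l by (simp add: field_simps power_add)
    finally show ?case .
  qed
  have tail: "dist (u n) (u m) \<le> R * l ^ n / (1 - l)" if "n \<le> m" for n m
  proof -
    have "dist (u n) (u m) \<le> R * l ^ n * (1 - l ^ (m - n)) / (1 - l)"
      using partial[of n "m - n"] that by simp
    also have "\<dots> \<le> R * l ^ n * 1 / (1 - l)"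
      using l assms(5) by (intro divide_right_mono mult_left_mono) auto
    finally show ?thesis by simp
  qed
  have "(\<lambda>n. R * l ^ n / (1 - l)) \<longlonglongrightarrow> R * 0 / (1 - l)"
    by (intro tendsto_intros LIMSEQ_realpow_zero) (use l in auto)
  then have small: "\<exists>N. \<forall>n\<ge>N. R * l ^ n / (1 - l) < e" if "0 < e" for e
    using order_tendstoD(2)[of _ 0 sequentially e] that by (auto simp: eventually_sequentially)
  have "Cauchy u"
  proof (rule metric_CauchyI)
    fix e :: real assume "0 < e"
    then obtain N where N: "\<And>n. n \<ge> N \<Longrightarrow> R * l ^ n / (1 - l) < e"
      using small by blast
    have "dist (u m) (u n) < e" if "m \<ge> N" "n \<ge> N" for m n
      using tail[of m n] tail[of n m] N[of m] N[of n] that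
      by (cases "m \<le> n") (auto simp: dist_commute)
    then show "\<exists>M. \<forall>m\<ge>M. \<forall>n\<ge>M. dist (u m) (u n) < e" by blast
  qed
  then obtain p where p: "p \<in> Y" "u \<longlonglongrightarrow> p"
    using assms(1,2) unfolding complete_def by blast
  have "dist (u n) p \<le> R * l ^ n / (1 - l)" for n
    by (rule tendsto_upperbound[where F = sequentially and f = "\<lambda>m. dist (u n) (u m)"])
      (use p tail in \<open>auto intro!: tendsto_dist eventually_sequentiallyI[of n]\<close>)
  then show ?thesis using p(1) by blast
qed

lemma exists_scale:
  fixes l :: real
  assumes "0 < l" "l < 1" and "0 < d" and "d < D"
  shows "\<exists>n. D * l ^ Suc n \<le> d \<and> d < D * l ^ n"
proof -
  obtain m where "l ^ m < d / D"
    using real_arch_pow_inv[of "d / D" l] assms by auto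
  then have m: "D * l ^ m \<le> d"
    using assms by (simp add: field_simps)
  define k where "k = (LEAST k. D * l ^ k \<le> d)"
  have k: "D * l ^ k \<le> d"
    unfolding k_def by (rule LeastI[of _ m]) (fact m)
  then have "k \<noteq> 0" using assms(4) by (intro notI) simp
  then obtain n where n: "k = Suc n" using not0_implies_Suc by blast
  have "\<not> D * l ^ n \<le> d"
    using not_less_Least[of n "\<lambda>k. D * l ^ k \<le> d"] n unfolding k_def by simp
  then show ?thesis using k n by auto
qed

section \<open>The embedding\<close>

text \<open>
  The factor \<open>4\<close> beats the drift of the limits: for \<open>l \<le> 1/4\<close> two limits differ from their
  placements at level \<open>n + 1\<close> by at most \<open>4/3 R l^(n+1)\<close> each, so at least \<open>4/3 R l^(n+1)\<close> of the
  separation remains.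
\<close>

lemma exists_bilipschitz_embedding_of_covering_numbers:
  fixes X :: "'a::metric_space set" and Y :: "'b::metric_space set"
  assumes X: "ultrametric_on X" and D: "0 < D" "\<And>x y. x \<in> X \<Longrightarrow> y \<in> X \<Longrightarrow> dist x y < D"
    and Y: "complete Y" "Y \<noteq> {}" and R: "0 < R" and l: "0 < l" "l \<le> 1 / 4"
    and fin: "\<And>x n. x \<in> X \<Longrightarrow> covering_number X (ball_in X x (D * l ^ n)) (D * l ^ Suc n) \<noteq> \<infinity>"
    and le: "\<And>x y n. x \<in> X \<Longrightarrow> y \<in> Y \<Longrightarrow>
      covering_number X (ball_in X x (D * l ^ n)) (D * l ^ Suc n)
        \<le> covering_number Y (ball_in Y y (R * l ^ n)) (4 * (R * l ^ Suc n))"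
  shows "\<exists>f. bilipschitz_embedding f X Y"
proof -
  let ?P = "\<lambda>n F. F ` X \<subseteq> Y \<and> (\<forall>x\<in>X. \<forall>y\<in>X. dist x y < D * l ^ n \<longrightarrow> F x = F y)"
  let ?Q = "\<lambda>n F G. (\<forall>x\<in>X. dist (F x) (G x) < R * l ^ n) \<and>
    (\<forall>x\<in>X. \<forall>y\<in>X. dist x y < D * l ^ n \<longrightarrow> D * l ^ Suc n \<le> dist x y \<longrightarrow>
      4 * (R * l ^ Suc n) \<le> dist (G x) (G y))"
  obtain y0 where y0: "y0 \<in> Y" using Y(2) by blast
  have "\<exists>F. \<forall>n. ?P n (F n) \<and> ?Q n (F n) (F (Suc n))"
  proof (rule dependent_nat_choice)
    show "\<exists>F. ?P 0 F" using y0 by (intro exI[of _ "\<lambda>_. y0"]) auto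
  next
    fix F n assume F: "?P n F"
    show "\<exists>G. ?P (Suc n) G \<and> ?Q n F G"
    proof (rule exists_refined_placement[OF X _ fin le])
      show "0 < 4 * (R * l ^ Suc n)" "0 < D * l ^ Suc n" "D * l ^ Suc n \<le> D * l ^ n"
        using D(1) R l by simp_all
      show "F ` X \<subseteq> Y" "\<forall>x\<in>X. \<forall>y\<in>X. dist x y < D * l ^ n \<longrightarrow> F x = F y"
        using F by blast+
    qed
  qed
  then obtain F where F: "\<forall>n. ?P n (F n) \<and> ?Q n (F n) (F (Suc n))" ..
  have FY: "F n x \<in> Y" if "x \<in> X" for n x
    using F that by blast
  have const: "F n x = F n y" if "x \<in> X" "y \<in> X" "dist x y < D * l ^ n" for n x y
    using F that by blast
  have near: "dist (F n x) (F (Suc n) x) < R * l ^ n" if "x \<in> X" for n x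
    using F that by blast
  have sep: "4 * (R * l ^ Suc n) \<le> dist (F (Suc n) x) (F (Suc n) y)"
    if "x \<in> X" "y \<in> X" "dist x y < D * l ^ n" "D * l ^ Suc n \<le> dist x y" for n x y
    using F that by blast
  have "\<exists>p\<in>Y. \<forall>n. dist (F n x) p \<le> R * l ^ n / (1 - l)" if "x \<in> X" for x
  proof (rule geometric_steps_converge[OF Y(1)])
    show "F n x \<in> Y" for n using FY[OF that] .
    show "dist (F n x) (F (Suc n) x) \<le> R * l ^ n" for n using near[OF that] by (rule less_imp_le)
  qed (use l R in auto)
  then obtain f where fY: "\<And>x. x \<in> X \<Longrightarrow> f x \<in> Y"
    and f: "\<And>x n. x \<in> X \<Longrightarrow> dist (F n x) (f x) \<le> R * l ^ n / (1 - l)"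
    by metis
  have drift: "dist (F n x) (f x) \<le> 4 / 3 * (R * l ^ n)" if "x \<in> X" for x n
  proof -
    have "R * l ^ n / (1 - l) \<le> R * l ^ n / (3 / 4)"
      using l R by (intro divide_left_mono) auto
    also have "\<dots> = 4 / 3 * (R * l ^ n)" by simp
    finally show ?thesis using f[OF that, of n] by linarith
  qed
  have lower: "R * l / D * dist x y \<le> dist (f x) (f y)"
    and upper: "dist (f x) (f y) \<le> 3 * R / (D * l) * dist x y"
    if xy: "x \<in> X" "y \<in> X" "x \<noteq> y" for x y
  proof -
    obtain n where n: "D * l ^ Suc n \<le> dist x y" "dist x y < D * l ^ n"
      using exists_scale[of l "dist x y" D] l D(2) xy by auto
    have pos: "0 < R * l ^ n" "0 < R * l ^ Suc n" using R l by auto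
    have "F n x = F n y" using const[OF xy(1,2) n(2)] .
    then have "dist (f x) (f y) \<le> dist (F n x) (f x) + dist (F n y) (f y)"
      by (metis dist_commute dist_triangle)
    also have "\<dots> \<le> 3 * (R * l ^ n)"
      using drift[OF xy(1), of n] drift[OF xy(2), of n] pos by linarith
    also have "\<dots> = 3 * R / (D * l) * (D * l ^ Suc n)"
      using D l by simp
    also have "\<dots> \<le> 3 * R / (D * l) * dist x y"
      using n R D l by (intro mult_left_mono) auto
    finally show "dist (f x) (f y) \<le> 3 * R / (D * l) * dist x y" .
    have "R * l / D * dist x y \<le> R * l / D * (D * l ^ n)"
      using n R D l by (intro mult_left_mono) auto
    also have "\<dots> = R * l ^ Suc n" using D by simp
    also have "\<dots> \<le> dist (f x) (f y)"
    proof -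
      have "4 * (R * l ^ Suc n) \<le> dist (F (Suc n) x) (F (Suc n) y)"
        using sep[OF xy(1,2) n(2,1)] .
      also have "\<dots> \<le> dist (F (Suc n) x) (f x) + dist (f x) (f y) + dist (F (Suc n) y) (f y)"
        by (metis add.assoc add_left_mono dist_commute dist_triangle order.trans)
      finally show ?thesis
        using drift[OF xy(1), of "Suc n"] drift[OF xy(2), of "Suc n"] pos by linarith
    qed
    finally show "R * l / D * dist x y \<le> dist (f x) (f y)" .
  qed
  have "1 / (D / (R * l)) * dist x y \<le> dist (f x) (f y) \<and>
      dist (f x) (f y) \<le> 3 * R / (D * l) * dist x y" if "x \<in> X" "y \<in> X" for x y
    using lower[of x y] upper[of x y] that by (cases "x = y") simp_all
  moreover have "0 < D / (R * l)" "0 < 3 * R / (D * l)"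
    using R D l by auto
  ultimately have "bilipschitz_embedding f X Y"
    unfolding bilipschitz_embedding_def using fY by blast
  then show ?thesis by blast
qed

text \<open>
  Written with \<open>t = 1/l\<close>, the inequality is \<open>C 4^q / c \<le> t^(q - s)\<close>, which holds for large \<open>t\<close>.
\<close>

lemma exists_ratio:
  fixes s q c C :: real
  assumes "s < q" and "0 < c" and "0 < C"
  shows "\<exists>l>0. l \<le> 1 / 8 \<and> C * (1 / l) powr s \<le> c * (1 / (4 * l)) powr q"
proof -
  define A where "A = C * 4 powr q / c"
  define t where "t = max 8 (A powr (1 / (q - s)))"
  have A: "0 < A" using assms by (simp add: A_def)
  have t: "8 \<le> t" "A powr (1 / (q - s)) \<le> t" by (simp_all add: t_def)
  have "A = (A powr (1 / (q - s))) powr (q - s)"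
    using A assms(1) by (simp add: powr_powr)
  also have "\<dots> \<le> t powr (q - s)"
    using t assms(1) by (intro powr_mono2) auto
  finally have "A * t powr s \<le> t powr (q - s) * t powr s"
    by (intro mult_right_mono) auto
  also have "\<dots> = t powr q" by (simp flip: powr_add)
  finally have "C * t powr s \<le> c * (t powr q / 4 powr q)"
    using assms(2) by (simp add: A_def field_simps)
  then have "C * t powr s \<le> c * (t / 4) powr q"
    using t by (simp add: powr_divide)
  then show ?thesis
    using t by (intro exI[of _ "1 / t"]) (auto simp: field_simps)
qed

theorem theorem1p3:
  fixes X :: "'a::metric_space set" and Y :: "'b::metric_space set"
  assumes "ultrametric_on X" and "bounded X"
    and "complete Y"
    and "\<exists>y1\<in>Y. \<exists>y2\<in>Y. y1 \<noteq> y2"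
    and "assouad_dim X < lower_assouad_dim Y"
  shows "\<exists>f. bilipschitz_embedding f X Y"
proof -
  obtain q c where c: "0 < c" and sup: "assouad_dim X < ereal q"
    and lowY: "\<And>y r R. y \<in> Y \<Longrightarrow> 0 < r \<Longrightarrow> r < R \<Longrightarrow> (bounded Y \<longrightarrow> R < diameter Y) \<Longrightarrow>
      ereal (c * (R / r) powr q) \<le> ereal_of_enat (covering_number Y (ball_in Y y R) r)"
    using assms(5) unfolding lower_assouad_dim_def less_Sup_iff by blast
  obtain s C where sq: "s < q" and C: "1 \<le> C"
    and upX: "\<And>x r R. x \<in> X \<Longrightarrow> 0 < r \<Longrightarrow> r < R \<Longrightarrow>
      ereal_of_enat (covering_number X (ball_in X x R) r) \<le> ereal (C * (R / r) powr s)"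
    using sup unfolding assouad_dim_def Inf_less_iff by auto
  obtain l where l: "0 < l" "l \<le> 1 / 8"
    and ratio: "C * (1 / l) powr s \<le> c * (1 / (4 * l)) powr q"
    using exists_ratio[OF sq c, of C] C by auto
  obtain R where R: "0 < R" "bounded Y \<longrightarrow> R < diameter Y"
  proof (cases "bounded Y")
    case True
    obtain y1 y2 where "y1 \<in> Y" "y2 \<in> Y" "y1 \<noteq> y2" using assms(4) by blast
    then have "0 < diameter Y"
      using diameter_bounded_bound[OF True, of y1 y2] by (metis not_less order.trans zero_less_dist_iff)
    then show ?thesis using that[of "diameter Y / 2"] by simp
  next
    case False
    then show ?thesis using that[of 1] by simp
  qed
  obtain B where B: "\<And>x y. x \<in> X \<Longrightarrow> y \<in> X \<Longrightarrow> dist x y \<le> B"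
    using assms(2) by (meson bounded_two_points)
  \<comment> \<open>Strictly larger than all distances, so that the open balls of radius \<open>D\<close> are all of \<open>X\<close>.\<close>
  define D where "D = \<bar>B\<bar> + 1"
  have scaleX: "ereal_of_enat (covering_number X (ball_in X x (D * l ^ n)) (D * l ^ Suc n))
      \<le> ereal (C * (1 / l) powr s)" if "x \<in> X" for x n
  proof -
    have "D * l ^ n / (D * l ^ Suc n) = 1 / l"
      using l by (simp add: D_def add_nonneg_eq_0_iff)
    moreover have "0 < D" by (simp add: D_def)
    ultimately show ?thesis
      using upX[OF that, of "D * l ^ Suc n" "D * l ^ n"] l by simp
  qed
  have scaleY: "ereal (c * (1 / (4 * l)) powr q)
      \<le> ereal_of_enat (covering_number Y (ball_in Y y (R * l ^ n)) (4 * (R * l ^ Suc n)))"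
    if "y \<in> Y" for y n
  proof -
    have "R * l ^ n / (4 * (R * l ^ Suc n)) = 1 / (4 * l)"
      using l R by simp
    moreover have "R * l ^ n \<le> R"
      using R l by (simp add: power_le_one)
    then have "bounded Y \<longrightarrow> R * l ^ n < diameter Y"
      using R(2) by auto
    ultimately show ?thesis
      using lowY[OF that, of "4 * (R * l ^ Suc n)" "R * l ^ n"] l R by simp
  qed
  show ?thesis
  proof (rule exists_bilipschitz_embedding_of_covering_numbers[OF assms(1) _ _ assms(3) _ R(1) l(1)])
    show "0 < D" by (simp add: D_def)
    show "dist x y < D" if "x \<in> X" "y \<in> X" for x y
      using B[OF that] by (simp add: D_def)
    show "Y \<noteq> {}" using assms(4) by blast
    show "l \<le> 1 / 4" using l by simp
    show "covering_number X (ball_in X x (D * l ^ n)) (D * l ^ Suc n) \<noteq> \<infinity>" if "x \<in> X" for x n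
      using scaleX[OF that, of n] by (intro notI) simp
    show "covering_number X (ball_in X x (D * l ^ n)) (D * l ^ Suc n)
        \<le> covering_number Y (ball_in Y y (R * l ^ n)) (4 * (R * l ^ Suc n))"
      if "x \<in> X" "y \<in> Y" for x y n
      using scaleX[OF that(1), of n] scaleY[OF that(2), of n] ratio
      by (meson ereal_less_eq(3) ereal_of_enat_le_iff order.trans)
  qed
qed

end
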